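(* Let $M$ be a finite loopless matroid with ground set $E$ and rank function $r$, let $\omega:E\to\mathbb{Z}_{\ge 0}$ be a weight function with non-negative integer values, and let $D$ be a positive integer. The following are equivalent: (a) There exists a mapping $\phi:E\to[D]=\{1,\dots,D\}$ such that for every $x\in[D]$ the set $\{\,e\in E\mid x\in[\,\phi(e),\,\phi(e)+\omega(e)\,)\,\}$ is independent in $M$. (b) For all $A\subseteq E$, we have $\omega(A)\le D\cdot r(A)$, where $\omega(A)=\sum_{a\in A}\omega(a)$.
   Context: $[D]$ is regarded as the $D$-gon, i.e. the sequence $(1,2,\dots,D)$ in cyclic order. For $e\in E$, the cyclic interval $[\,\phi(e),\,\phi(e)+\omega(e)\,)$ denotes the set of the $\omega(e)$ integers $\phi(e),\phi(e)+1,\dots,\phi(e)+\omega(e)-1$ taken modulo $D$ (as elements of $[D]$).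
   Formalization: In (a) it is also required that each cyclic interval [φ(e), φ(e)+ω(e)) has exactly ω(e) elements of [D], i.e. ω(e) ≤ D; without this (a) does not imply (b), e.g. for a single non-loop e with ω(e) = D+1. *)

theory Defs
  imports Main "HOL-Number_Theory.Cong"
begin

locale finite_matroid =
  fixes E :: "'a set" and indep :: "'a set \<Rightarrow> bool"
  assumes finite_ground: "finite E"
    and indep_subset_ground: "indep X \<Longrightarrow> X \<subseteq> E"
    and indep_empty: "indep {}"
    and indep_subset: "indep X \<Longrightarrow> Y \<subseteq> X \<Longrightarrow> indep Y"
    and augment: "indep X \<Longrightarrow> indep Y \<Longrightarrow> card Y < card X \<Longrightarrow> \<exists>x\<in>X - Y. indep (insert x Y)"
begin

definition rank :: "'a set \<Rightarrow> nat" where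
  "rank A = Max (card ` {X. X \<subseteq> A \<and> indep X})"

end

locale loopless_matroid = finite_matroid +
  assumes loopless: "e \<in> E \<Longrightarrow> indep {e}"

text \<open>The cyclic interval \<open>[a, a + w)\<close> on the \<open>D\<close>-gon: the residues modulo \<open>D\<close> of
  \<open>a, a + 1, \<dots>, a + w - 1\<close>, represented in \<open>{1..D}\<close> (so that \<open>D\<close>, rather than \<open>0\<close>,
  represents the zero class).\<close>

definition cyclic_interval :: "nat \<Rightarrow> nat \<Rightarrow> nat \<Rightarrow> nat set" where
  "cyclic_interval D a w = {x \<in> {1..D}. \<exists>i<w. [x = a + i] (mod D)}"

text \<open>As a plain set of residues, the interval collapses to the whole \<open>D\<close>-gon once \<open>w \<ge> D\<close>,
  so it is a set of \<open>w\<close> integers modulo \<open>D\<close> only if \<open>w \<le> D\<close>.\<close>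

lemma card_cyclic_interval:
  assumes "0 < D"
  shows "card (cyclic_interval D a w) = min w D"
proof -
  define h where "h i = Suc ((a + i + (D - 1)) mod D)" for i
  have h_cong: "[h i = a + i] (mod D)" for i
  proof -
    have "h i mod D = Suc (a + i + (D - 1)) mod D"
      by (simp add: h_def mod_Suc_eq)
    also have "Suc (a + i + (D - 1)) = a + i + D"
      using assms by simp
    finally show ?thesis by (simp add: cong_def)
  qed
  have h_range: "h i \<in> {1..D}" for i
    using assms by (simp add: h_def Suc_leI)
  have uniq: "x = y" if "x \<in> {1..D}" "y \<in> {1..D}" "[x = y] (mod D)" for x y
  proof -
    have "[x - 1 + 1 = y - 1 + 1] (mod D)"
      using that by simp
    then have "[x - 1 = y - 1] (mod D)"
      by (rule cong_add_rcancel_nat[THEN iffD1])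
    moreover have "x - 1 < D" "y - 1 < D"
      using that assms by auto
    ultimately have "x - 1 = y - 1"
      by (simp add: cong_def)
    with that show ?thesis by auto
  qed
  have "cyclic_interval D a w = h ` {..<min w D}"
  proof (intro equalityI subsetI)
    fix x assume "x \<in> cyclic_interval D a w"
    then obtain i where x: "x \<in> {1..D}" "i < w" "[x = a + i] (mod D)"
      by (auto simp: cyclic_interval_def)
    have "[a + i = a + i mod D] (mod D)"
      by (simp add: cong_def mod_add_right_eq)
    then have "[x = h (i mod D)] (mod D)"
      using x(3) h_cong cong_trans cong_sym by blast
    then have "x = h (i mod D)"
      using uniq x(1) h_range by blast
    moreover have "i mod D < min w D"
      using x(2) assms by (simp add: le_less_trans[OF mod_less_eq_dividend])
    ultimately show "x \<in> h ` {..<min w D}" by blast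
  next
    fix x assume "x \<in> h ` {..<min w D}"
    then show "x \<in> cyclic_interval D a w"
      unfolding cyclic_interval_def using h_cong h_range by auto
  qed
  moreover have "inj_on h {..<min w D}"
  proof (rule inj_onI)
    fix i j assume ij: "i \<in> {..<min w D}" "j \<in> {..<min w D}" "h i = h j"
    then have "[a + i = a + j] (mod D)"
      using h_cong cong_trans cong_sym by metis
    then have "[i = j] (mod D)"
      by (rule cong_add_lcancel_nat[THEN iffD1])
    with ij show "i = j" by (simp add: cong_def)
  qed
  ultimately show ?thesis by (simp add: card_image)
qed

end

(* The packing is built by raising the weights one unit at a time. Lengthening one interval makes
   at most one position x of the D-gon dependent, and there the active set contains a unique circuit.
   Some element of the circuit starts at x, since the active set at x - 1 is independent; shift the
   element that has been shifted least (measured by unreduced start positions) by one step, which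
   moves the defect to the far end of its interval. If this never ends, let A be the set of elements
   shifted infinitely often. Eventually only A moves and all defect circuits lie in A, so the span of
   the active elements of A at each position stays constant and, as every element of A visits every
   position, contains A. Counting ranks over all positions, with the surplus at the defect, gives
   w(A) > D r(A). *)

theory Submission
  imports Defs
begin

context finite_matroid
begin

section \<open>Rank function: bases and submodularity\<close>

lemma finite_indep: "indep X \<Longrightarrow> finite X"
  using finite_ground finite_subset indep_subset_ground by blast

lemma finite_indep_subsets: "finite {X. X \<subseteq> A \<and> indep X}"
  by (rule finite_subset[of _ "Pow E"]) (use finite_ground indep_subset_ground in auto)

lemma card_le_rank: "indep X \<Longrightarrow> X \<subseteq> A \<Longrightarrow> card X \<le> rank A"
  unfolding rank_def by (rule Max_ge) (use finite_indep_subsets in auto)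

lemma rank_attained: "\<exists>X\<subseteq>A. indep X \<and> card X = rank A"
proof -
  have "rank A \<in> card ` {X. X \<subseteq> A \<and> indep X}"
    unfolding rank_def by (rule Max_in) (use finite_indep_subsets indep_empty in auto)
  then show ?thesis by auto
qed

lemma rank_mono: "A \<subseteq> B \<Longrightarrow> rank A \<le> rank B"
  by (metis card_le_rank rank_attained subset_trans)

lemma rank_indep: "indep X \<Longrightarrow> rank X = card X"
  by (metis antisym card_le_rank card_mono finite_indep order_refl rank_attained)

lemma rank_le_card: "finite X \<Longrightarrow> rank X \<le> card X"
  by (metis card_mono rank_attained)

lemma rank_dependent: "finite X \<Longrightarrow> \<not> indep X \<Longrightarrow> rank X < card X"
  by (metis psubsetI psubset_card_mono rank_attained)

text \<open>Augmenting from a largest independent subset of \<open>A\<close> adds one element of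
  \<open>A\<close> at a time; the induction is on the number of elements still missing.\<close>

lemma extend_indep:
  assumes "indep X" "X \<subseteq> A"
  shows "\<exists>Z. X \<subseteq> Z \<and> Z \<subseteq> A \<and> indep Z \<and> card Z = rank A"
  using assms
proof (induction "rank A - card X" arbitrary: X)
  case 0
  then show ?case using card_le_rank[of X A] by (intro exI[of _ X]) auto
next
  case (Suc k)
  obtain Y where Y: "Y \<subseteq> A" "indep Y" "card Y = rank A" using rank_attained by blast
  obtain a where a: "a \<in> Y - X" "indep (insert a X)"
    using augment[of Y X] Y Suc.prems Suc.hyps(2) by force
  have "card (insert a X) = Suc (card X)" using a finite_indep[OF Suc.prems(1)] by auto
  then have "k = rank A - card (insert a X)" using Suc.hyps(2) by auto
  with Suc.hyps(1)[of "insert a X"] a Y Suc.prems show ?case by auto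
qed

text \<open>A basis \<open>X\<close> of the intersection extends to a basis \<open>Z\<close> of the
  union. Its traces on \<open>A\<close> and \<open>B\<close> are independent, together cover
  \<open>Z\<close>, and both contain \<open>X\<close>.\<close>

lemma rank_submodular: "rank (A \<union> B) + rank (A \<inter> B) \<le> rank A + rank B"
proof -
  obtain X where X: "X \<subseteq> A \<inter> B" "indep X" "card X = rank (A \<inter> B)" using rank_attained by blast
  obtain Z where Z: "X \<subseteq> Z" "Z \<subseteq> A \<union> B" "indep Z" "card Z = rank (A \<union> B)"
    using extend_indep[of X "A \<union> B"] X by auto
  have fin: "finite Z" using Z finite_indep by auto
  have "card (Z \<inter> A) + card (Z \<inter> B) = card ((Z \<inter> A) \<union> (Z \<inter> B)) + card ((Z \<inter> A) \<inter> (Z \<inter> B))"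
    using fin by (intro card_Un_Int) auto
  moreover have un: "(Z \<inter> A) \<union> (Z \<inter> B) = Z" using Z by auto
  moreover have "card X \<le> card ((Z \<inter> A) \<inter> (Z \<inter> B))" using X Z fin by (intro card_mono) auto
  moreover have "card (Z \<inter> A) \<le> rank A" "card (Z \<inter> B) \<le> rank B"
    using Z indep_subset by (auto intro!: card_le_rank)
  ultimately show ?thesis using X(3) Z(4) unfolding un by linarith
qed

section \<open>Closure operator\<close>

text \<open>The matroid span, not cut down to \<open>E\<close>: elements outside \<open>E\<close>
  belong to every closure, as no independent set contains them.\<close>

definition closure :: "'a set \<Rightarrow> 'a set" where
  "closure X = {e. rank (insert e X) = rank X}"

text \<open>Submodularity for \<open>insert e X\<close> and \<open>Y\<close> bounds the rank gained
  by adding \<open>e\<close> to \<open>Y\<close> by the rank gained by adding it to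
  \<open>X\<close>.\<close>

lemma closure_mono:
  assumes "X \<subseteq> Y"
  shows "closure X \<subseteq> closure Y"
proof
  fix e assume "e \<in> closure X"
  then have e: "rank (insert e X) = rank X" by (simp add: closure_def)
  have "insert e X \<union> Y = insert e Y" using assms by auto
  then have "rank (insert e Y) + rank (insert e X \<inter> Y) \<le> rank (insert e X) + rank Y"
    using rank_submodular[of "insert e X" Y] by simp
  moreover have "rank X \<le> rank (insert e X \<inter> Y)" using assms by (intro rank_mono) auto
  moreover have "rank Y \<le> rank (insert e Y)" by (intro rank_mono) auto
  ultimately show "e \<in> closure Y" using e by (simp add: closure_def)
qed

lemma rank_Un_closure:
  assumes "finite Z" "Z \<subseteq> closure X"
  shows "rank (X \<union> Z) = rank X"
  using assms
proof (induction Z)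
  case (insert e Z)
  then have "e \<in> closure (X \<union> Z)" using closure_mono[of X "X \<union> Z"] by auto
  with insert show ?case by (simp add: closure_def)
qed simp

lemma closure_Un:
  assumes "finite Z" "Z \<subseteq> closure X"
  shows "closure (X \<union> Z) = closure X"
proof
  show "closure (X \<union> Z) \<subseteq> closure X"
  proof
    fix e assume e: "e \<in> closure (X \<union> Z)"
    have "rank (insert e X) \<le> rank (insert e (X \<union> Z))" by (intro rank_mono) auto
    moreover have "rank X \<le> rank (insert e X)" by (intro rank_mono) auto
    ultimately show "e \<in> closure X"
      using e rank_Un_closure[OF assms] by (simp add: closure_def)
  qed
qed (rule closure_mono, auto)

lemma closure_eqI:
  assumes "finite Y" "X \<subseteq> Y" "rank Y \<le> rank X"
  shows "closure X = closure Y"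
proof -
  have "Y \<subseteq> closure X"
  proof
    fix e assume "e \<in> Y"
    then have "rank (insert e X) \<le> rank Y" using assms by (intro rank_mono) auto
    moreover have "rank X \<le> rank (insert e X)" by (intro rank_mono) auto
    ultimately show "e \<in> closure X" using assms by (simp add: closure_def)
  qed
  with closure_Un[of Y X] assms show ?thesis by (simp add: Un_absorb1)
qed

lemma subset_closure: "X \<subseteq> closure X"
  by (auto simp: closure_def insert_absorb)

lemma not_in_closure_Diff:
  assumes "indep X" "n \<in> X"
  shows "n \<notin> closure (X - {n})"
proof -
  have "indep (X - {n})" using assms indep_subset by blast
  with assms have "rank (X - {n}) < rank X"
    using finite_indep by (metis card_Diff1_less rank_indep)
  with assms show ?thesis by (simp add: closure_def insert_absorb)
qed

section \<open>Circuit of an independent set plus one element\<close>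

text \<open>If \<open>U\<close> is an independent set plus one element, this is its unique circuit.\<close>

definition circuit_in :: "'a set \<Rightarrow> 'a set" where
  "circuit_in U = {h \<in> U. indep (U - {h})}"

text \<open>If the set were independent, it would extend to a basis \<open>Z\<close> of
  \<open>U\<close>. Because of \<open>h\<close>, \<open>Z\<close> misses exactly one element
  \<open>k\<close>, so \<open>U - {k}\<close> is independent and \<open>k\<close> belongs to the
  set, yet \<open>k\<close> is not in \<open>Z\<close>.\<close>

lemma circuit_in_dependent:
  assumes "\<not> indep U" "h \<in> circuit_in U"
  shows "\<not> indep (circuit_in U)"
proof
  assume C: "indep (circuit_in U)"
  have h: "h \<in> U" "indep (U - {h})" using assms by (auto simp: circuit_in_def)
  have fin: "finite U" using finite_indep[OF h(2)] by simp
  obtain Z where Z: "circuit_in U \<subseteq> Z" "Z \<subseteq> U" "indep Z" "card Z = rank U"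
    using extend_indep[OF C, of U] by (auto simp: circuit_in_def)
  have "card (U - {h}) \<le> card Z" using Z h card_le_rank[of "U - {h}" U] by auto
  then have "card U - 1 \<le> card Z" using h fin by simp
  have "Z \<noteq> U" using Z(3) assms(1) by blast
  then obtain k where k: "k \<in> U - Z" using Z(2) by blast
  have "Z \<subseteq> U - {k}" using Z k by auto
  moreover have "card (U - {k}) \<le> card Z" using \<open>card U - 1 \<le> card Z\<close> fin k by simp
  ultimately have "Z = U - {k}" using fin by (intro card_seteq) auto
  then have "k \<in> circuit_in U" using k Z by (auto simp: circuit_in_def)
  with k Z show False by auto
qed

lemma circuit_in_closure:
  assumes "\<not> indep U" "n \<in> circuit_in U"
  shows "n \<in> closure (circuit_in U - {n})"
proof -
  have "circuit_in U - {n} \<subseteq> U - {n}" by (auto simp: circuit_in_def)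
  then have I: "indep (circuit_in U - {n})" using assms indep_subset by (auto simp: circuit_in_def)
  then have fin: "finite (circuit_in U)" using finite_indep by fastforce
  have "rank (circuit_in U) < card (circuit_in U)"
    using circuit_in_dependent[OF assms] fin by (intro rank_dependent)
  then have "rank (circuit_in U) \<le> rank (circuit_in U - {n})"
    using fin assms(2) I by (simp add: rank_indep)
  moreover have "rank (circuit_in U - {n}) \<le> rank (circuit_in U)" by (intro rank_mono) auto
  ultimately show ?thesis using assms(2) by (simp add: closure_def insert_absorb)
qed

text \<open>With \<open>K\<close> off the circuit, \<open>U - K\<close> is still dependent, while
  removing \<open>g\<close> leaves an independent set with one element fewer, so the ranks agree.
  \<open>K\<close> stands for elements disregarded when spans are compared before and after a
  push.\<close>

lemma closure_remove_circuit:
  assumes "\<not> indep U" "g \<in> circuit_in U" "circuit_in U \<inter> K = {}"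
  shows "closure (U - {g} - K) = closure (U - K)"
proof (rule closure_eqI)
  have g: "g \<in> U - K" "indep (U - {g})" using assms by (auto simp: circuit_in_def)
  show fin: "finite (U - K)" using finite_indep[OF g(2)] by simp
  show "U - {g} - K \<subseteq> U - K" by auto
  have "circuit_in U \<subseteq> U - K" using assms(3) by (auto simp: circuit_in_def)
  then have "\<not> indep (U - K)" using circuit_in_dependent[OF assms(1,2)] indep_subset by blast
  then have "rank (U - K) < card (U - K)" using fin by (intro rank_dependent)
  moreover have "rank (U - {g} - K) = card (U - {g} - K)"
    using g(2) indep_subset[of "U - {g}" "U - {g} - K"] by (intro rank_indep) auto
  moreover have "U - {g} - K = (U - K) - {g}" by auto
  ultimately show "rank (U - K) \<le> rank (U - {g} - K)" using g(1) fin by simp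
qed

end

section \<open>Arcs on the \<open>D\<close>-gon\<close>

lemma arc_full:
  fixes D a y :: nat
  assumes "0 < D"
  shows "\<exists>i<D. [y = a + i] (mod D)"
proof -
  have "\<exists>i. [a + i = y] (mod D)"
  proof
    \<comment> \<open>The offset \<open>y + a * (D - 1)\<close> plays the role of
      \<open>y - a\<close> without truncated subtraction.\<close>
    have "a + (y + a * (D - 1)) = y + a * D"
      using assms by (cases D) auto
    then show "[a + (y + a * (D - 1)) = y] (mod D)"
      unfolding cong_def by (metis mod_mult_self1)
  qed
  then obtain i where "[a + i = y] (mod D)" by blast
  then have "[y = a + i mod D] (mod D)" by (simp add: cong_def mod_add_right_eq)
  with assms show ?thesis by (intro exI[of _ "i mod D"]) auto
qed

text \<open>One step forward drops \<open>a\<close> and gains \<open>a + w\<close>. The bound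
  \<open>w < D\<close> keeps the class of \<open>a\<close> from reappearing among
  \<open>a + 1, ..., a + w\<close>.\<close>

lemma arc_shift:
  fixes D a y w :: nat
  assumes "0 < w" "w < D"
  shows "(\<exists>i<w. [y = Suc a + i] (mod D)) \<longleftrightarrow>
    (\<exists>i<w. [y = a + i] (mod D)) \<and> \<not> [y = a] (mod D) \<or> [y = a + w] (mod D)"
proof -
  have ne: "\<not> [a + i = a] (mod D)" if "0 < i" "i < D" for i
    using that cong_add_lcancel_nat[of a i 0 D] by (auto simp: cong_def)
  have *: "\<not> [y = a] (mod D)" if "[y = Suc a + i] (mod D)" "i < w" for i
  proof
    assume "[y = a] (mod D)"
    then have "[a + Suc i = a] (mod D)" using that cong_trans cong_sym
      by (metis add_Suc_shift)
    with ne[of "Suc i"] that assms show False by auto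
  qed
  have "(\<exists>i<w. [y = Suc a + i] (mod D)) \<longleftrightarrow> (\<exists>i\<in>{1..w}. [y = a + i] (mod D))"
    (is "_ \<longleftrightarrow> ?R")
  proof
    assume "\<exists>i<w. [y = Suc a + i] (mod D)"
    then obtain i where "i < w" "[y = a + Suc i] (mod D)" by auto
    then show ?R by (intro bexI[of _ "Suc i"]) auto
  next
    assume ?R
    then obtain i where "i \<in> {1..w}" "[y = a + i] (mod D)" by auto
    then show "\<exists>i<w. [y = Suc a + i] (mod D)" by (intro exI[of _ "i - 1"]) auto
  qed
  also have "\<dots> \<longleftrightarrow> (\<exists>i<w. [y = a + i] (mod D)) \<and> \<not> [y = a] (mod D) \<or> [y = a + w] (mod D)"
  proof
    assume ?R
    then obtain i where i: "i \<in> {1..w}" "[y = a + i] (mod D)" by auto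
    then have "\<not> [y = a] (mod D)" using ne[of i] assms cong_trans cong_sym
      by (metis atLeastAtMost_iff le_less_trans less_eq_Suc_le One_nat_def)
    with i show "(\<exists>i<w. [y = a + i] (mod D)) \<and> \<not> [y = a] (mod D) \<or> [y = a + w] (mod D)"
      by (cases "i = w") (auto intro!: exI[of _ i])
  next
    assume "(\<exists>i<w. [y = a + i] (mod D)) \<and> \<not> [y = a] (mod D) \<or> [y = a + w] (mod D)"
    then show ?R
    proof
      assume "(\<exists>i<w. [y = a + i] (mod D)) \<and> \<not> [y = a] (mod D)"
      then obtain i where "i < w" "[y = a + i] (mod D)" "\<not> [y = a] (mod D)" by auto
      then show ?R by (intro bexI[of _ i]) (cases i; auto)+
    next
      assume "[y = a + w] (mod D)"
      then show ?R using assms by (intro bexI[of _ w]) auto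
    qed
  qed
  finally show ?thesis .
qed

section \<open>Active sets\<close>

locale weighted_matroid = finite_matroid +
  fixes D :: nat and w :: "'a \<Rightarrow> nat"
  assumes D_pos: "0 < D" and weight_le: "e \<in> E \<Longrightarrow> w e \<le> D"
begin

text \<open>Start positions are unreduced natural numbers, read modulo \<open>D\<close>, so that they record how far
  each interval has been shifted.\<close>

definition active :: "('a \<Rightarrow> nat) \<Rightarrow> nat \<Rightarrow> 'a set" where
  "active p y = {e \<in> E. \<exists>i<w e. [y = p e + i] (mod D)}"

lemma finite_active: "finite (active p y)"
  using finite_ground by (auto simp: active_def)

lemma active_cong: "[y = z] (mod D) \<Longrightarrow> active p y = active p z"
  unfolding active_def by (meson cong_sym cong_trans)

lemma active_before:
  assumes "e \<in> active p (Suc y)" "\<not> [p e = Suc y] (mod D)"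
  shows "e \<in> active p y"
proof -
  obtain i where i: "e \<in> E" "i < w e" "[Suc y = p e + i] (mod D)"
    using assms by (auto simp: active_def)
  then have "i \<noteq> 0" using assms(2) cong_sym by (cases i) auto
  then obtain j where "i = Suc j" by (cases i) auto
  then have "[y + 1 = (p e + j) + 1] (mod D)" using i by simp
  then have "[y = p e + j] (mod D)" by (rule cong_add_rcancel_nat[THEN iffD1])
  then show ?thesis using i \<open>i = Suc j\<close> by (auto simp: active_def intro!: exI[of _ j])
qed

lemma active_weight_full:
  assumes "e \<in> E" "w e = D"
  shows "e \<in> active p y"
  using assms arc_full[OF D_pos] by (auto simp: active_def)

lemma active_shift_full:
  assumes "g \<in> E" "w g = D"
  shows "active (p(g := k)) y = active p y"
proof -
  have "e \<in> active (p(g := k)) y \<longleftrightarrow> e \<in> active p y" for e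
  proof (cases "e = g")
    case True
    then show ?thesis using active_weight_full[OF assms] by metis
  qed (simp add: active_def)
  then show ?thesis by auto
qed

lemma active_shift:
  assumes "g \<in> E" "0 < w g" "w g < D"
  shows "active (p(g := Suc (p g))) y =
    (if [y = p g + w g] (mod D) then insert g (active p y)
     else if [y = p g] (mod D) then active p y - {g} else active p y)"
  using arc_shift[OF assms(2,3), of y "p g"] assms(1)
  unfolding active_def by (intro set_eqI) (auto split: if_splits)

section \<open>Defects and pushes\<close>

text \<open>A nonempty \<open>circuit_in\<close> says that the active set is an independent set plus
  one element. The position \<open>x\<close> is unreduced and matters only modulo
  \<open>D\<close>.\<close>

definition defect :: "('a \<Rightarrow> nat) \<Rightarrow> nat \<Rightarrow> bool" where
  "defect p x \<longleftrightarrow> \<not> indep (active p x) \<and> circuit_in (active p x) \<noteq> {} \<and>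
     (\<forall>y. \<not> [y = x] (mod D) \<longrightarrow> indep (active p y))"

text \<open>The choice of the smallest unreduced start is what later prevents a lagging element from
  being passed over forever.\<close>

definition push :: "('a \<Rightarrow> nat) \<Rightarrow> nat \<Rightarrow> 'a \<Rightarrow> bool" where
  "push p x g \<longleftrightarrow> defect p x \<and> g \<in> circuit_in (active p x) \<and> [p g = x] (mod D) \<and>
     (\<forall>h\<in>circuit_in (active p x). [p h = x] (mod D) \<longrightarrow> p g \<le> p h)"

text \<open>If no element of the circuit started at \<open>x\<close>, the whole circuit would
  already be active one position earlier, where the active set is independent.\<close>

lemma push_exists:
  assumes "defect p x"
  shows "\<exists>g. push p x g"
proof -
  let ?C = "circuit_in (active p x)"
  let ?H = "{g \<in> ?C. [p g = x] (mod D)}"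
  have "?H \<noteq> {}"
  proof
    assume H: "?H = {}"
    have "\<not> indep ?C" using assms circuit_in_dependent by (auto simp: defect_def)
    \<comment> \<open>The predecessor of \<open>x\<close> modulo \<open>D\<close>; adding
      \<open>D\<close> first covers \<open>x = 0\<close>.\<close>
    define y where "y = x + D - 1"
    have y: "[Suc y = x] (mod D)" using D_pos by (simp add: y_def cong_def)
    have "?C \<subseteq> active p y"
    proof
      fix e assume e: "e \<in> ?C"
      then have "\<not> [p e = x] (mod D)" using H by auto
      then have "\<not> [p e = Suc y] (mod D)" using y cong_trans by blast
      moreover have "e \<in> active p (Suc y)"
        using e active_cong[OF y] by (auto simp: circuit_in_def)
      ultimately show "e \<in> active p y" using active_before by blast
    qed
    then have "\<not> indep (active p y)" using \<open>\<not> indep ?C\<close> indep_subset by blast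
    \<comment> \<open>The predecessor can coincide with \<open>x\<close> only if
      \<open>D = 1\<close>, and then every element starts at \<open>x\<close>.\<close>
    then have "[y = x] (mod D)" using assms by (auto simp: defect_def)
    then have "[x + 1 = x + 0] (mod D)" using y
      by (metis Suc_eq_plus1 add.right_neutral cong_add_rcancel_nat cong_sym cong_trans)
    then have "[1 = 0] (mod D)" by (rule cong_add_lcancel_nat[THEN iffD1])
    then have "D = 1" by (simp add: cong_0_iff)
    then have "[p e = x] (mod D)" for e by (simp add: cong_def)
    then show False using H assms unfolding defect_def by blast
  qed
  moreover have "finite ?H" using finite_active by (auto simp: circuit_in_def)
  ultimately obtain g where "g \<in> ?H" "\<forall>h\<in>?H. p g \<le> p h"
    using arg_min_if_finite(1)[of ?H p] arg_min_least[of ?H _ p] by blast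
  with assms show ?thesis by (auto simp: push_def)
qed

lemma push_mem: "push p x g \<Longrightarrow> g \<in> active p x"
  by (auto simp: push_def circuit_in_def)

text \<open>The push removes \<open>g\<close> at \<open>p g\<close>, which breaks the circuit there,
  and adds it at \<open>p g + w g\<close>, where the set was independent. Hence a new defect can
  only be there, and \<open>bad\<close> forces one. The second claim records that an active set
  changes only by a member of its circuit, so its span can be tracked.\<close>

lemma push_step:
  assumes "push p x g" and bad: "\<not> (\<forall>y. indep (active (p(g := Suc (p g))) y))"
  shows "\<exists>x'. defect (p(g := Suc (p g))) x'"
    and "active (p(g := Suc (p g))) y = active p y \<or>
      \<not> indep (active p y) \<and> g \<in> circuit_in (active p y) \<and>
        active (p(g := Suc (p g))) y = active p y - {g} \<or>
      \<not> indep (active (p(g := Suc (p g))) y) \<and> g \<in> circuit_in (active (p(g := Suc (p g))) y) \<and>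
        active p y = active (p(g := Suc (p g))) y - {g}"
proof -
  let ?p = "p(g := Suc (p g))"
  have g: "g \<in> E" "0 < w g" using push_mem[OF assms(1)] by (auto simp: active_def)
  have d: "defect p x" "g \<in> circuit_in (active p x)" "[p g = x] (mod D)"
    using assms(1) by (auto simp: push_def)
  have px: "active p (p g) = active p x" using d active_cong by blast
  have "(\<exists>x'. defect ?p x') \<and> (active ?p y = active p y \<or>
      \<not> indep (active p y) \<and> g \<in> circuit_in (active p y) \<and> active ?p y = active p y - {g} \<or>
      \<not> indep (active ?p y) \<and> g \<in> circuit_in (active ?p y) \<and> active p y = active ?p y - {g})"
  \<comment> \<open>An interval of length \<open>D\<close> covers every position: the push changes
    only the recorded shift, and the old defect remains.\<close>
  proof (cases "w g = D")
    case True
    then have "active ?p = active p" using active_shift_full g by blast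
    then show ?thesis using d by (auto simp: defect_def)
  next
    case False
    then have wD: "w g < D" using weight_le g by force
    note S = active_shift[OF g wD, of p]
    let ?x = "p g + w g"
    have ne: "\<not> [?x = p g] (mod D)"
      using cong_add_lcancel_nat[of "p g" "w g" 0 D] g wD by (auto simp: cong_def)
    then have nx: "\<not> [?x = x] (mod D)" using d(3) cong_trans cong_sym by blast
    have Ix: "indep (active p ?x)" using d nx by (auto simp: defect_def)
    have gx: "g \<notin> active p ?x"
    proof
      assume "g \<in> active p ?x"
      then obtain i where "i < w g" "[?x = p g + i] (mod D)" by (auto simp: active_def)
      then have "[w g = i] (mod D)" by (simp add: cong_add_lcancel_nat)
      then show False using \<open>i < w g\<close> wD by (auto simp: cong_def)
    qed
    have Sx: "active ?p ?x = insert g (active p ?x)" using S by simp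
    have oth: "indep (active ?p z)" if "\<not> [z = ?x] (mod D)" for z
    proof (cases "[z = p g] (mod D)")
      case True
      then have "active ?p z = active p x - {g}" using S that active_cong px by metis
      then show ?thesis using d by (auto simp: circuit_in_def)
    next
      case False
      then have "\<not> [z = x] (mod D)" using d(3) cong_trans cong_sym by blast
      then show ?thesis using S that False d by (auto simp: defect_def)
    qed
    have dep: "\<not> indep (active ?p ?x)"
      using bad oth active_cong[of _ ?x ?p] by metis
    have circ: "g \<in> circuit_in (active ?p ?x)" "active p ?x = active ?p ?x - {g}"
      using Sx gx Ix by (auto simp: circuit_in_def)
    have "defect ?p ?x" using dep circ oth by (auto simp: defect_def)
    moreover consider "[y = ?x] (mod D)" | "\<not> [y = ?x] (mod D)" "[y = p g] (mod D)"
      | "\<not> [y = ?x] (mod D)" "\<not> [y = p g] (mod D)" by blast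
    then have "active ?p y = active p y \<or>
      \<not> indep (active p y) \<and> g \<in> circuit_in (active p y) \<and> active ?p y = active p y - {g} \<or>
      \<not> indep (active ?p y) \<and> g \<in> circuit_in (active ?p y) \<and> active p y = active ?p y - {g}"
    proof cases
      case 1
      then have "active ?p y = active ?p ?x" "active p y = active p ?x" using active_cong by blast+
      then show ?thesis using dep circ by metis
    next
      case 2
      then have "active p y = active p x" using active_cong px by metis
      moreover have "active ?p y = active p y - {g}" using S 2 by simp
      moreover have "\<not> indep (active p x)" using d by (auto simp: defect_def)
      ultimately show ?thesis using d by simp
    next
      case 3
      then show ?thesis using S by simp
    qed
    ultimately show ?thesis by blast
  qed
  then show "\<exists>x'. defect ?p x'"
    and "active ?p y = active p y \<or>
      \<not> indep (active p y) \<and> g \<in> circuit_in (active p y) \<and> active ?p y = active p y - {g} \<or>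
      \<not> indep (active ?p y) \<and> g \<in> circuit_in (active ?p y) \<and> active p y = active ?p y - {g}"
    by auto
qed

section \<open>Counting weights and termination of pushing\<close>

lemma sum_card_active:
  assumes "A \<subseteq> E"
  shows "(\<Sum>y\<in>{1..D}. card (active p y \<inter> A)) = (\<Sum>a\<in>A. w a)"
proof -
  have fin: "finite A" using assms finite_ground finite_subset by blast
  have "(\<Sum>y\<in>{1..D}. card (active p y \<inter> A)) =
      (\<Sum>y\<in>{1..D}. \<Sum>a\<in>A. if a \<in> active p y then 1 else 0)"
    using fin by (intro sum.cong refl) (simp add: sum.If_cases Int_commute)
  also have "\<dots> = (\<Sum>a\<in>A. \<Sum>y\<in>{1..D}. if a \<in> active p y then 1 else 0)"
    by (rule sum.swap)
  also have "\<dots> = (\<Sum>a\<in>A. card {y \<in> {1..D}. a \<in> active p y})"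
    by (intro sum.cong refl) (simp add: sum.If_cases Int_def)
  also have "\<dots> = (\<Sum>a\<in>A. w a)"
  proof (intro sum.cong refl)
    fix a assume "a \<in> A"
    then have "{y \<in> {1..D}. a \<in> active p y} = cyclic_interval D (p a) (w a)"
      using assms by (auto simp: active_def cyclic_interval_def)
    \<comment> \<open>Since \<open>w a \<le> D\<close>, the interval does not overlap itself and
      covers exactly \<open>w a\<close> positions.\<close>
    then show "card {y \<in> {1..D}. a \<in> active p y} = w a"
      using card_cyclic_interval[OF D_pos] weight_le \<open>a \<in> A\<close> assms by (simp add: subset_iff)
  qed
  finally show ?thesis .
qed

lemma push_run_terminates:
  fixes P :: "nat \<Rightarrow> 'a \<Rightarrow> nat"
  assumes push: "\<And>t. push (P t) (x t) (g t)"
    and step: "\<And>t. P (Suc t) = (P t)(g t := Suc (P t (g t)))"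
    and cap: "\<And>A. A \<subseteq> E \<Longrightarrow> (\<Sum>a\<in>A. w a) \<le> D * rank A"
  shows False
proof -
  have dft: "defect (P t) (x t)" for t using push by (auto simp: push_def)
  then have bad: "\<not> (\<forall>y. indep (active (P t) y))" for t by (auto simp: defect_def)
  have gE: "g t \<in> E" "0 < w (g t)" for t using push_mem[OF push, of t] by (auto simp: active_def)
  have mono: "P s e \<le> P t e" if "s \<le> t" for s t e
    by (rule lift_Suc_mono_le[of "\<lambda>t. P t e"]) (use step that in auto)
  \<comment> \<open>Starts grow in unit steps, so being unbounded is the same as being shifted
    infinitely often.\<close>
  define A where "A = {e \<in> E. \<forall>k. \<exists>t. k < P t e}"
  have AE: "A \<subseteq> E" by (auto simp: A_def)
  have fin: "finite A" "finite (E - A)" using AE finite_ground finite_subset by auto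
  have ev1: "\<forall>\<^sub>F T in sequentially. \<forall>n\<in>E - A. \<forall>t. P t n \<le> P T n"
  proof (intro eventually_ball_finite fin ballI)
    fix n assume "n \<in> E - A"
    then obtain k where "\<forall>t. P t n \<le> k" by (auto simp: A_def not_less)
    then obtain T where T: "\<forall>t. P t n \<le> P T n"
      using ex_has_greatest_nat[of "\<lambda>_. True" 0 "\<lambda>t. P t n" "Suc k"] by (auto simp: less_Suc_eq_le)
    then have "\<forall>t. P t n \<le> P T' n" if "T \<le> T'" for T' using mono[OF that] le_trans by blast
    then show "\<forall>\<^sub>F T in sequentially. \<forall>t. P t n \<le> P T n"
      by (auto simp: eventually_sequentially)
  qed
  then obtain T0 where T0: "\<forall>n\<in>E - A. \<forall>t. P t n \<le> P T0 n"
    by (auto simp: eventually_sequentially)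
  \<comment> \<open>The sum is a convenient common upper bound for all starts outside
    \<open>A\<close>.\<close>
  define K where "K = (\<Sum>n\<in>E - A. P T0 n)"
  have K: "P t n \<le> K" if "n \<in> E - A" for t n
  proof -
    have "P T0 n \<le> K" unfolding K_def using that fin by (intro member_le_sum) auto
    with T0 that show ?thesis using le_trans by blast
  qed
  have "\<forall>\<^sub>F T in sequentially. \<forall>a\<in>A. K < P T a"
  proof (intro eventually_ball_finite fin ballI)
    fix a assume "a \<in> A"
    then obtain t where "K < P t a" by (auto simp: A_def)
    then have "K < P T a" if "t \<le> T" for T using mono[OF that] less_le_trans by blast
    then show "\<forall>\<^sub>F T in sequentially. K < P T a"
      by (auto simp: eventually_sequentially)
  qed
  with ev1 have "\<forall>\<^sub>F T in sequentially. (\<forall>n\<in>E - A. \<forall>t. P t n \<le> P T n) \<and> (\<forall>a\<in>A. K < P T a)"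
    by (rule eventually_conj)
  \<comment> \<open>From \<open>T\<close> on, elements outside \<open>A\<close> are frozen and lie
    strictly behind all elements of \<open>A\<close>.\<close>
  then obtain T where T: "\<And>n t. n \<in> E - A \<Longrightarrow> P t n \<le> P T n" "\<And>a. a \<in> A \<Longrightarrow> K < P T a"
    unfolding eventually_sequentially by (meson order_refl)
  have frozen: "P t n = P T n" if "n \<in> E - A" "T \<le> t" for t n
    using T(1)[of n t] mono[of T t n] that by auto
  have sep: "P t n < P t a" if "n \<in> E - A" "a \<in> A" "T \<le> t" for t n a
    using T(2)[of a] K[of n t] mono[of T t a] that by auto
  have gA: "g t \<in> A" if "T \<le> t" for t
  proof (rule ccontr)
    assume "g t \<notin> A"
    then have "P (Suc t) (g t) = P T (g t)" "P t (g t) = P T (g t)"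
      using frozen[of "g t" t] frozen[of "g t" "Suc t"] gE(1)[of t] that by auto
    with step[of t] show False by simp
  qed
  have wA: "0 < w a" if a: "a \<in> A" for a
  proof (rule ccontr)
    assume "\<not> 0 < w a"
    then have "a \<noteq> g t" for t using gE by metis
    then have "P t a = P 0 a" for t using step by (induction t) auto
    moreover obtain t where "P 0 a < P t a" using a by (auto simp: A_def)
    ultimately show False by (metis less_irrefl)
  qed
  have hit: "\<exists>t\<ge>T. P t a = P T a + i" if "a \<in> A" for a i
  proof (induction i)
    case (Suc i)
    then obtain t where t: "T \<le> t" "P t a = P T a + i" by auto
    have ex: "\<exists>s. P T a + i < P s a" using that by (auto simp: A_def)
    \<comment> \<open>At the first time the start exceeds \<open>P T a + i\<close>, it does so by
      exactly one, as a step raises it by at most one.\<close>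
    define s where "s = (LEAST s. P T a + i < P s a)"
    have s: "P T a + i < P s a" unfolding s_def using ex by (rule LeastI_ex)
    have "t < s" using s t mono[of s t a] by (cases "s \<le> t") auto
    then obtain s' where s': "s = Suc s'" by (cases s) auto
    have "\<not> P T a + i < P s' a"
      using not_less_Least[of s' "\<lambda>s. P T a + i < P s a"] s' unfolding s_def by simp
    moreover have "P s a \<le> Suc (P s' a)" using step[of s'] s' by auto
    ultimately have "P s a = P T a + Suc i" using s by auto
    with \<open>t < s\<close> t show ?case by (intro exI[of _ s]) auto
  qed auto
  \<comment> \<open>The start of \<open>a\<close> runs through all residues, and by
    \<open>wA\<close> the element is active at its own start.\<close>
  have visit: "\<exists>t\<ge>T. a \<in> active (P t) y" if a: "a \<in> A" for a y
  proof -
    obtain i where "[y = P T a + i] (mod D)" using arc_full[OF D_pos] by blast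
    moreover obtain t where "T \<le> t" "P t a = P T a + i" using hit[OF a] by blast
    ultimately have "a \<in> active (P t) y"
      using AE wA[OF a] a unfolding active_def by (auto intro!: exI[of _ 0])
    with \<open>T \<le> t\<close> show ?thesis by blast
  qed
  \<comment> \<open>If \<open>N\<close> never meets the circuit at \<open>y\<close>, pushes preserve
    the span of the active set without \<open>N\<close>; each \<open>a\<close> is active at
    \<open>y\<close> at some time, hence spanned at all times. This is applied to
    \<open>N = {n}\<close> and to \<open>N = E - A\<close>.\<close>
  have span: "A \<subseteq> closure (active (P t) y - N)"
    if N: "N \<inter> A = {}" and t: "T \<le> t"
      and avoid: "\<And>t. T \<le> t \<Longrightarrow> \<not> indep (active (P t) y) \<Longrightarrow> circuit_in (active (P t) y) \<inter> N = {}"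
    for N t y
  proof -
    have const: "closure (active (P t) y - N) = closure (active (P T) y - N)" if "T \<le> t" for t
      using that
    proof (induction t rule: dec_induct)
      case (step t)
      \<comment> \<open>When \<open>g\<close> leaves \<open>y\<close>, the circuit is in the earlier
        set; when \<open>g\<close> enters, it is in the later one, and the removal lemma is read
        backwards.\<close>
      have "closure (active (P (Suc t)) y - N) = closure (active (P t) y - N)"
        using push_step(2)[OF push[of t], of y] bad[of "Suc t"]
          avoid[of t] avoid[of "Suc t"] step.hyps closure_remove_circuit[of _ "g t" N]
        unfolding assms(2)[of t, symmetric] by (metis le_SucI)
      with step show ?case by simp
    qed simp
    show ?thesis
    proof
      fix a assume a: "a \<in> A"
      then obtain s where s: "T \<le> s" "a \<in> active (P s) y" using visit by blast
      then have "a \<in> closure (active (P s) y - N)" using subset_closure a N by blast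
      then show "a \<in> closure (active (P t) y - N)" using const s t by metis
    qed
  qed
  \<comment> \<open>A frozen element of the circuit starting at the defect would have been shifted instead.\<close>
  have start: "e \<in> A" if "T \<le> t" "\<not> indep (active (P t) y)" "e \<in> circuit_in (active (P t) y)"
    "[P t e = y] (mod D)" for t y e
  proof (rule ccontr)
    assume e: "e \<notin> A"
    have yx: "[y = x t] (mod D)" using dft[of t] that by (auto simp: defect_def)
    then have "P t (g t) \<le> P t e"
      using push[of t] that active_cong[OF yx] cong_trans unfolding push_def by metis
    moreover have "e \<in> E - A" using e that by (auto simp: circuit_in_def active_def)
    ultimately show False using sep[of e "g t" t] gA that by fastforce
  qed
  \<comment> \<open>Induction along the interval of \<open>n\<close>: every element of the circuit at the next position lies in
    \<open>A\<close> or is already active one position earlier, where \<open>A\<close> is spanned without \<open>n\<close>.\<close>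
  have avoid: "n \<notin> circuit_in (active (P t) y)"
    if n: "n \<in> E - A" and "[y = P T n + i] (mod D)" "i < w n"
      "T \<le> t" "\<not> indep (active (P t) y)" for n y i t
    using that(2-)
  proof (induction i arbitrary: y t)
    case 0
    then have "[P t n = y] (mod D)" using frozen[OF n 0(3)] by (simp add: cong_sym)
    with 0 show ?case using start[of t y n] n by blast
  next
    case (Suc i)
    define z where "z = P T n + i"
    have yz: "active (P t) y = active (P t) (Suc z)"
      using Suc.prems(1) by (intro active_cong) (simp add: z_def)
    let ?C = "circuit_in (active (P t) (Suc z))"
    let ?S = "active (P t) z"
    have dep: "\<not> indep (active (P t) (Suc z))" using Suc.prems yz by simp
    \<comment> \<open>All times from \<open>T\<close> on are required, because \<open>span\<close>
      follows position \<open>z\<close> through the whole run.\<close>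
    have IH: "n \<notin> circuit_in (active (P t) z)" if "T \<le> t" "\<not> indep (active (P t) z)" for t
      using Suc.IH[of z t] that Suc.prems by (auto simp: z_def)
    have A: "A \<subseteq> closure (?S - {n})"
      using span[of "{n}" t z] n Suc.prems IH by blast
    have nS: "n \<in> ?S"
      using n Suc.prems(2) frozen[OF n Suc.prems(3)] by (auto simp: active_def z_def intro!: exI[of _ i])
    \<comment> \<open>If \<open>?S\<close> is dependent, deleting some \<open>h\<close> of its
      circuit makes it independent. By \<open>IH\<close> the circuit avoids \<open>n\<close>, so
      this does not alter the span of \<open>?S - {n}\<close>.\<close>
    have nc: "n \<notin> closure (?S - {n})"
    proof (cases "indep ?S")
      case True
      then show ?thesis using not_in_closure_Diff nS by blast
    next
      case False
      then have "[z = x t] (mod D)" using dft by (auto simp: defect_def)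
      then have "circuit_in ?S \<noteq> {}" using dft[of t] active_cong unfolding defect_def by metis
      then obtain h where h: "h \<in> circuit_in ?S" by blast
      have nC: "n \<notin> circuit_in ?S" using IH Suc.prems False by blast
      then have "closure (?S - {h} - {n}) = closure (?S - {n})"
        using closure_remove_circuit[OF False h, of "{n}"] by blast
      moreover have "indep (?S - {h})" "n \<in> ?S - {h}" using h nC nS by (auto simp: circuit_in_def)
      ultimately show ?thesis using not_in_closure_Diff[of "?S - {h}" n] by simp
    qed
    show ?case
    proof
      assume "n \<in> circuit_in (active (P t) y)"
      then have nC: "n \<in> ?C" using yz by simp
      have "?C - {n} \<subseteq> (?S - {n}) \<union> A"
      proof
        fix e assume e: "e \<in> ?C - {n}"
        show "e \<in> (?S - {n}) \<union> A"
        proof (cases "[P t e = Suc z] (mod D)")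
          case True
          then show ?thesis using start[OF Suc.prems(3) dep] e by blast
        next
          case False
          then show ?thesis using active_before e by (auto simp: circuit_in_def)
        qed
      qed
      \<comment> \<open>The rest of its circuit spans \<open>n\<close>; as \<open>A\<close> adds
        nothing to the closure of \<open>?S - {n}\<close>, that closure would contain
        \<open>n\<close>, against \<open>nc\<close>.\<close>
      then have "n \<in> closure ((?S - {n}) \<union> A)"
        using circuit_in_closure[OF dep nC] closure_mono by blast
      then show False using closure_Un[OF fin(1) A] nc by simp
    qed
  qed
  have avoid_all: "circuit_in (active (P t) y) \<inter> (E - A) = {}"
    if "T \<le> t" "\<not> indep (active (P t) y)" for t y
  proof (rule ccontr)
    assume "circuit_in (active (P t) y) \<inter> (E - A) \<noteq> {}"
    then obtain n where n: "n \<in> circuit_in (active (P t) y)" "n \<in> E - A" by blast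
    then obtain i where "i < w n" "[y = P t n + i] (mod D)"
      by (auto simp: circuit_in_def active_def)
    then show False using avoid[OF n(2), of y i t] frozen[OF n(2) that(1)] that n(1) by simp
  qed
  have rank_le: "rank A \<le> rank (active (P T) y \<inter> A)" for y
  proof -
    have "A \<subseteq> closure (active (P T) y - (E - A))"
      using span[of "E - A" T y] avoid_all by blast
    moreover have "active (P T) y - (E - A) = active (P T) y \<inter> A" by (auto simp: active_def)
    ultimately have "rank (active (P T) y \<inter> A \<union> A) = rank (active (P T) y \<inter> A)"
      using rank_Un_closure[OF fin(1)] by metis
    then show ?thesis by (simp add: Un_absorb1)
  qed
  have le: "rank A \<le> card (active (P T) y \<inter> A)" for y
    using rank_le rank_le_card[of "active (P T) y \<inter> A"] fin le_trans by blast
  \<comment> \<open>\<open>1 + i\<close> is the representative of the defect in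
    \<open>{1..D}\<close>.\<close>
  obtain i where i: "i < D" "[x T = 1 + i] (mod D)" using arc_full[OF D_pos] by blast
  \<comment> \<open>The circuit lies inside \<open>A\<close>, so the active elements of
    \<open>A\<close> are dependent here and outnumber the rank.\<close>
  have lt: "rank A < card (active (P T) (1 + i) \<inter> A)"
  proof -
    let ?U = "active (P T) (1 + i)"
    have U: "?U = active (P T) (x T)" using active_cong i cong_sym by blast
    then have dep: "\<not> indep ?U" "circuit_in ?U \<noteq> {}" using dft[of T] by (auto simp: defect_def)
    then have "\<not> indep (circuit_in ?U)" using circuit_in_dependent by blast
    moreover have "circuit_in ?U \<subseteq> ?U \<inter> A"
      using avoid_all[OF order_refl dep(1)] by (auto simp: circuit_in_def active_def)
    ultimately have "\<not> indep (?U \<inter> A)" using indep_subset by blast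
    then show ?thesis
      using rank_le[of "1 + i"] rank_dependent[of "?U \<inter> A"] fin by simp
  qed
  have "(\<Sum>y\<in>{1..D}. rank A) < (\<Sum>y\<in>{1..D}. card (active (P T) y \<inter> A))"
    using le lt i by (intro sum_strict_mono_ex1) auto
  then show False using sum_card_active[OF AE] cap[OF AE] by simp
qed

end

section \<open>Existence of a packing and the equivalence\<close>

context finite_matroid
begin

text \<open>Singletons have rank at most one, so the bound for \<open>{e}\<close> gives
  \<open>w e \<le> D\<close>.\<close>

lemma weighted_matroidI:
  assumes "0 < D" "\<And>A. A \<subseteq> E \<Longrightarrow> (\<Sum>a\<in>A. w a) \<le> D * rank A"
  shows "weighted_matroid E indep D w"
proof unfold_locales
  fix e assume "e \<in> E"
  then have "w e \<le> D * rank {e}" using assms(2)[of "{e}"] by simp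
  also have "\<dots> \<le> D * 1" using rank_le_card[of "{e}"] by (intro mult_le_mono2) simp
  finally show "w e \<le> D" by simp
qed (rule assms(1))

text \<open>Induction on the total weight: one unit of some \<open>f\<close> is removed, the rest is
  packed, and the unit is restored. If no packing existed, the resulting defect could be pushed
  forever.\<close>

lemma cyclic_packing_exists:
  assumes "0 < D" "\<And>A. A \<subseteq> E \<Longrightarrow> (\<Sum>a\<in>A. w a) \<le> D * rank A"
  shows "\<exists>p. \<forall>y. indep (weighted_matroid.active E D w p y)"
  using assms(2)
proof (induction "\<Sum>a\<in>E. w a" arbitrary: w)
  case 0
  interpret weighted_matroid E indep D w by (rule weighted_matroidI[OF assms(1) 0(2)])
  have "active p y = {}" for p y using 0(1) finite_ground by (auto simp: active_def)
  then show ?case using indep_empty by auto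
next
  case (Suc k)
  interpret weighted_matroid E indep D w by (rule weighted_matroidI[OF assms(1) Suc.prems])
  obtain f where f: "f \<in> E" "0 < w f"
    using Suc.hyps(2) by (metis gr0I sum.neutral nat.distinct(1))
  define v where "v = w(f := w f - 1)"
  have vw: "v a \<le> w a" for a by (simp add: v_def)
  have "(\<Sum>a\<in>E. v a) = (\<Sum>a\<in>E - {f}. v a) + v f"
    using f finite_ground by (simp add: sum.remove add.commute)
  moreover have "(\<Sum>a\<in>E. w a) = (\<Sum>a\<in>E - {f}. w a) + w f"
    using f finite_ground by (simp add: sum.remove add.commute)
  moreover have "(\<Sum>a\<in>E - {f}. v a) = (\<Sum>a\<in>E - {f}. w a)"
    by (intro sum.cong) (auto simp: v_def)
  ultimately have "k = (\<Sum>a\<in>E. v a)" using f Suc.hyps(2) by (simp add: v_def)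
  moreover have v: "(\<Sum>a\<in>A. v a) \<le> D * rank A" if "A \<subseteq> E" for A
    using Suc.prems[OF that] sum_mono[of A v w] vw le_trans by blast
  ultimately obtain p where p: "\<And>y. indep (weighted_matroid.active E D v p y)"
    using Suc.hyps(1) by blast
  interpret V: weighted_matroid E indep D v by (rule weighted_matroidI[OF assms(1) v])
  show ?case
  proof (rule ccontr)
    assume no: "\<not> ?case"
    \<comment> \<open>The restored unit sits at offset \<open>v f = w f - 1\<close>, so only the
      active set at \<open>?x\<close> can grow, and only by \<open>f\<close>.\<close>
    let ?x = "p f + v f"
    have sub: "active p y - {f} \<subseteq> V.active p y" for y
      by (auto simp: active_def V.active_def) (auto simp: v_def)
    have ne: "active p y \<subseteq> V.active p y" if "\<not> [y = ?x] (mod D)" for y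
    proof
      fix e assume "e \<in> active p y"
      then obtain i where i: "e \<in> E" "i < w e" "[y = p e + i] (mod D)"
        by (auto simp: active_def)
      then have "i < v e" using that by (cases "e = f"; cases "i = v f") (auto simp: v_def)
      with i show "e \<in> V.active p y" by (auto simp: V.active_def)
    qed
    then have ind: "indep (active p y)" if "\<not> [y = ?x] (mod D)" for y
      using p indep_subset that by blast
    then have "\<not> indep (active p ?x)" using no active_cong[of _ ?x p] by metis
    moreover have "f \<in> active p ?x"
      using f by (auto simp: active_def v_def intro!: exI[of _ "w f - 1"])
    then have "f \<in> circuit_in (active p ?x)"
      using indep_subset[OF p sub] by (simp add: circuit_in_def)
    ultimately have "defect p ?x" using ind by (auto simp: defect_def)
    \<comment> \<open>By \<open>no\<close>, every push leaves a defect, so dependent choice gives an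
      infinite run.\<close>
    then have "\<exists>P. \<forall>t. (\<exists>x. defect (P t) x) \<and>
      (\<exists>x g. push (P t) x g \<and> P (Suc t) = (P t)(g := Suc (P t g)))"
    proof (intro dependent_nat_choice)
      fix q assume "\<exists>x. defect q x"
      then obtain x g where xg: "push q x g" using push_exists by blast
      then have "\<exists>x'. defect (q(g := Suc (q g))) x'" using push_step(1) no by blast
      with xg show "\<exists>q'. (\<exists>x. defect q' x) \<and> (\<exists>x g. push q x g \<and> q' = q(g := Suc (q g)))"
        by blast
    qed blast
    then obtain P x g where "\<And>t. push (P t) (x t) (g t)"
      "\<And>t. P (Suc t) = (P t)(g t := Suc (P t (g t)))" by metis
    then show False using push_run_terminates Suc.prems by blast
  qed
qed

end

text \<open>The cardinality clause makes each interval a genuine set of \<open>\<omega> e\<close>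
  integers modulo \<open>D\<close>, that is, \<open>\<omega> e \<le> D\<close>. Necessity of the
  bound is double counting over the positions.\<close>

theorem theorem2p1:
  fixes E :: "'a set" and indep :: "'a set \<Rightarrow> bool"
    and \<omega> :: "'a \<Rightarrow> nat" and D :: nat
  assumes "loopless_matroid E indep" and "D > 0"
  shows "(\<exists>\<phi> :: 'a \<Rightarrow> nat. \<phi> ` E \<subseteq> {1..D} \<and>
            (\<forall>e\<in>E. card (cyclic_interval D (\<phi> e) (\<omega> e)) = \<omega> e) \<and>
            (\<forall>x\<in>{1..D}. indep {e \<in> E. x \<in> cyclic_interval D (\<phi> e) (\<omega> e)}))
         \<longleftrightarrow> (\<forall>A\<subseteq>E. (\<Sum>a\<in>A. \<omega> a) \<le> D * finite_matroid.rank indep A)"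
    (is "(\<exists>\<phi>. ?packing \<phi>) \<longleftrightarrow> ?bound")
proof -
  interpret loopless_matroid E indep by (rule assms)
  have act: "{e \<in> E. x \<in> cyclic_interval D (\<phi> e) (\<omega> e)} = weighted_matroid.active E D \<omega> \<phi> x"
    if "weighted_matroid E indep D \<omega>" "x \<in> {1..D}" for x and \<phi> :: "'a \<Rightarrow> nat"
    using that by (auto simp: cyclic_interval_def weighted_matroid.active_def)
  show ?thesis
  proof
    assume "\<exists>\<phi>. ?packing \<phi>"
    then obtain \<phi> where \<phi>: "?packing \<phi>" by blast
    interpret weighted_matroid E indep D \<omega>
    proof unfold_locales
      fix e assume "e \<in> E"
      then show "\<omega> e \<le> D" using \<phi> card_cyclic_interval[OF assms(2)] by (metis min.cobounded2)
    qed (rule assms(2))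
    show ?bound
    proof (intro allI impI)
      fix A assume A: "A \<subseteq> E"
      have "(\<Sum>a\<in>A. \<omega> a) = (\<Sum>y\<in>{1..D}. card (active \<phi> y \<inter> A))"
        using sum_card_active[OF A] by simp
      also have "\<dots> \<le> (\<Sum>y\<in>{1..D}. rank A)"
      proof (intro sum_mono card_le_rank)
        fix y assume "y \<in> {1..D}"
        then have "indep (active \<phi> y)" using \<phi> act weighted_matroid_axioms by metis
        then show "indep (active \<phi> y \<inter> A)" using indep_subset by blast
      qed auto
      finally show "(\<Sum>a\<in>A. \<omega> a) \<le> D * rank A" by simp
    qed
  next
    assume bound: ?bound
    then obtain p where p: "\<And>y. indep (weighted_matroid.active E D \<omega> p y)"
      using cyclic_packing_exists[OF assms(2)] by blast
    interpret weighted_matroid E indep D \<omega>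
      using bound by (intro weighted_matroidI assms(2)) blast
    \<comment> \<open>Reduction into \<open>{1..D}\<close>: shifting by \<open>D - 1\<close> before
      \<open>mod\<close> and by one after it sends multiples of \<open>D\<close> to \<open>D\<close>
      instead of \<open>0\<close>.\<close>
    define \<phi> where "\<phi> e = Suc ((p e + (D - 1)) mod D)" for e
    have "[\<phi> e = p e] (mod D)" for e
    proof -
      have "Suc (p e + (D - 1)) = p e + D" using assms(2) by simp
      then show ?thesis by (simp add: \<phi>_def cong_def mod_Suc_eq)
    qed
    then have "[y = \<phi> e + i] (mod D) \<longleftrightarrow> [y = p e + i] (mod D)" for y e i
      by (meson cong_add_rcancel_nat cong_sym cong_trans)
    then have "active \<phi> y = active p y" for y by (simp add: active_def)
    then have "indep {e \<in> E. x \<in> cyclic_interval D (\<phi> e) (\<omega> e)}" if "x \<in> {1..D}" for x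
      using act[OF weighted_matroid_axioms that] p by simp
    moreover have "\<phi> ` E \<subseteq> {1..D}" using assms(2) by (auto simp: \<phi>_def Suc_leI)
    ultimately show "\<exists>\<phi>. ?packing \<phi>"
      using card_cyclic_interval[OF assms(2)] weight_le by (intro exI[of _ \<phi>]) auto
  qed
qed

end
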